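(* Let $d\ge 2$, $r>0$, let $a,b\in\mathbb{Z}^d$ be linearly independent, and let $f:\mathbb{Z}^d\to\mathbb{C}$ satisfy $\operatorname{supp} f\subseteq B_r\cap\mathbb{Z}^d$. Let the lines $\gamma_z$ ($z\in\mathbb{Z}^d$), the family $\mathcal{T}^\star=\{\gamma_z: z\in\mathbb{Z}^d\}$, and the sets $\mathcal{A}_{\alpha,\beta,a,b}$, $\mathcal{T}^\star_{\alpha,\beta,a,b}$ be as defined in the context (they depend on $a,b$). Then: (i) $\mathcal{P}f$ on $\mathcal{T}^\star$ uniquely determines $f$. (ii) This determination is given by the following formulas. Let $\Xi=\Xi_{a,b}+x_0$ be any two-dimensional plane with $x_0\in\mathbb{R}^d$, $x_0\cdot a=0$, $x_0\cdot b=0$, and $\Xi\cap\mathbb{Z}^d\ne\emptyset$ (for $d=2$: $\Xi=\mathbb{R}^2$, $x_0=0$). If $B_r\cap\Xi\cap\mathbb{Z}^d\neq\emptyset$, let $S_1,\dots,S_J$ be the layers of $B_r\cap\Xi\cap\mathbb{Z}^d$ with respect to $x_0$, as defined in the context. Then $$f(z)=\mathcal{P}f(\gamma_z),\quad z\in S_1,$$ $$f(z)=\mathcal{P}f(\gamma_z)-\sum_{\zeta\in\gamma_z\cap(\cup_{k=1}^{i}S_k)}f(\zeta),\quad z\in S_{i+1},\quad i=1,\dots,J-1.$$ (iii) For all $0\le\alpha\le\beta$ with $\beta\ge r$, $\mathcal{P}f$ on $\mathcal{T}^\star_{\alpha,\beta,a,b}$ uniquely determines $f$ on $\mathcal{A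}_{\alpha,\beta,a,b}$.
   Context: $B_r=\{x\in\mathbb{R}^d: |x|\le r\}$. An oriented line (ray) $\gamma=(\theta,x)$ is the line $\{x+t\theta: t\in\mathbb{R}\}$ with orientation (direction) $\theta\in\mathbb{S}^{d-1}$, where $x\in\mathbb{R}^d$, $x\cdot\theta=0$. For an oriented line $\gamma$ containing at least one point of $\mathbb{Z}^d$, the discrete X-ray transform is $\mathcal{P}f(\gamma)=\sum_{y\in\gamma\cap\mathbb{Z}^d}f(y)$. $\Omega=\{z/|z|: z\in\mathbb{Z}^d\setminus\{0\}\}$ and $\Xi_{a,b}=\operatorname{span}\{a,b\}\subset\mathbb{R}^d$. Fix some $\theta\in\Omega\cap\Xi_{a,b}$. For $z\in\mathbb{Z}^d$: - if $(z\cdot a)^2+(z\cdot b)^2\ne0$, then $\gamma_z=\{z+t\hat z_\star: t\in\mathbb{R}\}$ with direction $\hat z_\star=\dfrac{-(z\cdot b)a+(z\cdot a)b}{|-(z\cdot b)a+(z\cdot a)b|}$; - if $(z\cdot a)^2+(z\cdot b)^2=0$, then $\gamma_z=\{z+t\theta: t\in\mathbb{R}\}$ with direction $\theta$. For $z\in\mathbb{R}^d$ write $z=z_{a,b}+z^{a,b}$ with $z_{a,b}\in\Xi_{a,b}$ the orthogonal projection of $z$ onto $\Xi_{a,b}$ (so $z_{a,b}\cdot z^{a,b}=0$). For $0\le\alpha\le\beta$: $\mathcal{A}_{\alpha,\beta,a,b}=\{z\in\mathbb{Z}^d: \alpha\le|z_{a,b}|\le\beta\}$ and $\mathcal{T}^\star_{\alpha,\beta,a,b}=\{\gamma_z: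 z\in\mathbb{Z}^d,\ \alpha\le|z_{a,b}|\le\beta\}$. Layers: for a finite nonempty set $E\subset\mathbb{R}^d$ and a point $x_0$, the layers $S_1,\dots,S_J$ of $E$ with respect to $x_0$ are defined inductively by $S_1=\{z\in E: |z-x_0|\ge|\zeta-x_0|\ \forall\zeta\in E\}$ and $S_{i+1}=\{z\in E\setminus\cup_{k=1}^iS_k: |z-x_0|\ge|\zeta-x_0|\ \forall\zeta\in E\setminus\cup_{k=1}^iS_k\}$, where $J$ is the number of nonempty sets so obtained; thus $E$ is the disjoint union of $S_1,\dots,S_J$, ordered by strictly decreasing distance to $x_0$ (the point $x_0$ need not belong to $E$). "$\mathcal{P}f$ on a set of lines uniquely determines $f$ (on a set $A$)" means: if two functions on $\mathbb{Z}^d$, both supported in $B_r\cap\mathbb{Z}^d$, have the same $\mathcal{P}$ on all lines in that set, then they coincide (on $A$). *)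

theory Defs
  imports "HOL-Analysis.Analysis"
begin

text \<open>\<open>\<int>\<^sup>d\<close> is the type \<^typ>\<open>int ^ 'n\<close>, embedded into \<open>\<real>\<^sup>d\<close> by \<open>real_vec\<close>.\<close>

definition real_vec :: "int ^ 'n \<Rightarrow> real ^ 'n" where
  "real_vec z = (\<chi> i. of_int (z $ i))"

definition supp :: "(int ^ 'n \<Rightarrow> complex) \<Rightarrow> (int ^ 'n) set" where
  "supp f = {z. f z \<noteq> 0}"

definition lattice_ball :: "real \<Rightarrow> (int ^ 'n) set" where
  "lattice_ball r = {z. real_vec z \<in> cball 0 r}"

text \<open>An oriented line is a pair \<open>(\<theta>, x)\<close> of its direction and its point orthogonal to the
  direction; this representation is unique.\<close>

type_synonym 'n ray = "(real ^ 'n) \<times> (real ^ 'n)"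

definition rays :: "'n::finite ray set" where
  "rays = {(\<theta>, x). norm \<theta> = 1 \<and> x \<bullet> \<theta> = 0}"

definition ray_points :: "'n::finite ray \<Rightarrow> (real ^ 'n) set" where
  "ray_points \<gamma> = {snd \<gamma> + t *\<^sub>R fst \<gamma> | t. True}"

text \<open>For finitely supported \<open>f\<close> the infinite sum is the sum over the finitely many lattice
  points of the line at which \<open>f\<close> does not vanish.\<close>

definition xray :: "(int ^ 'n \<Rightarrow> complex) \<Rightarrow> 'n::finite ray \<Rightarrow> complex" where
  "xray f \<gamma> = infsum f {y. real_vec y \<in> ray_points \<gamma>}"

definition Omega :: "(real ^ 'n) set" where
  "Omega = {real_vec z /\<^sub>R norm (real_vec z) | z. z \<noteq> 0}"

definition Xi :: "int ^ 'n \<Rightarrow> int ^ 'n \<Rightarrow> (real ^ 'n) set" where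
  "Xi a b = span {real_vec a, real_vec b}"

definition star_dir :: "int ^ 'n \<Rightarrow> int ^ 'n \<Rightarrow> int ^ 'n \<Rightarrow> real ^ 'n" where
  "star_dir a b z =
    (let w = - (real_vec z \<bullet> real_vec b) *\<^sub>R real_vec a + (real_vec z \<bullet> real_vec a) *\<^sub>R real_vec b
     in w /\<^sub>R norm w)"

text \<open>The base point \<open>z\<close> is orthogonal to the direction in both cases; see \<open>gamma_in_rays\<close>.\<close>

definition gamma :: "int ^ 'n \<Rightarrow> int ^ 'n \<Rightarrow> real ^ 'n \<Rightarrow> int ^ 'n \<Rightarrow> 'n::finite ray" where
  "gamma a b \<theta> z =
    (if (real_vec z \<bullet> real_vec a)\<^sup>2 + (real_vec z \<bullet> real_vec b)\<^sup>2 \<noteq> 0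
     then (star_dir a b z, real_vec z) else (\<theta>, real_vec z))"

lemma gamma_in_rays:
  assumes ind: "independent {real_vec a, real_vec b}" "a \<noteq> b"
    and th: "\<theta> \<in> Omega \<inter> Xi a b"
  shows "gamma a b \<theta> z \<in> rays"
proof -
  have inj: "real_vec x = real_vec y \<longleftrightarrow> x = y" for x y :: "int ^ 'a"
    by (auto simp: real_vec_def vec_eq_iff)
  have z0: "real_vec (0 :: int ^ 'a) = 0"
    by (simp add: real_vec_def vec_eq_iff)
  show ?thesis
  proof (cases "(real_vec z \<bullet> real_vec a)\<^sup>2 + (real_vec z \<bullet> real_vec b)\<^sup>2 \<noteq> 0")
    case True
    define w where "w = - (real_vec z \<bullet> real_vec b) *\<^sub>R real_vec a
      + (real_vec z \<bullet> real_vec a) *\<^sub>R real_vec b"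
    have "w \<noteq> 0"
    proof
      assume w: "w = 0"
      define u where "u = (\<lambda>v. if v = real_vec a then - (real_vec z \<bullet> real_vec b)
        else real_vec z \<bullet> real_vec a)"
      have "(\<Sum>v\<in>{real_vec a, real_vec b}. u v *\<^sub>R v) = 0"
        using w ind(2) by (auto simp: w_def u_def inj)
      then have "\<forall>v\<in>{real_vec a, real_vec b}. u v = 0"
        using ind(1) by (auto simp: dependent_finite)
      then show False using True ind(2) by (auto simp: u_def inj)
    qed
    moreover have "real_vec z \<bullet> w = 0"
      by (simp add: w_def inner_add_right algebra_simps)
    moreover have "star_dir a b z = w /\<^sub>R norm w"
      by (simp only: star_dir_def Let_def w_def)
    ultimately show ?thesis
      using True by (simp add: gamma_def rays_def)
  next
    case False
    then have orth: "real_vec z \<bullet> real_vec a = 0" "real_vec z \<bullet> real_vec b = 0"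
      by (auto simp: sum_power2_eq_zero_iff)
    from th have "\<theta> \<in> span {real_vec a, real_vec b}" by (simp add: Xi_def)
    then obtain k l where "\<theta> - k *\<^sub>R real_vec a = l *\<^sub>R real_vec b"
      by (auto simp: span_breakdown_eq)
    then have "\<theta> = k *\<^sub>R real_vec a + l *\<^sub>R real_vec b"
      by (simp add: algebra_simps)
    then have "real_vec z \<bullet> \<theta> = 0"
      using orth by (simp add: inner_add_right)
    moreover have "norm \<theta> = 1"
    proof -
      obtain y where y: "y \<noteq> 0" "\<theta> = real_vec y /\<^sub>R norm (real_vec y)"
        using th by (auto simp: Omega_def)
      then have "real_vec y \<noteq> 0" using inj[of y 0] z0 by simp
      then show ?thesis using y by simp
    qed
    ultimately show ?thesis using False by (simp add: gamma_def rays_def)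
  qed
qed

definition orth_proj :: "(real ^ 'n) set \<Rightarrow> real ^ 'n \<Rightarrow> real ^ 'n" where
  "orth_proj V z = (THE p. p \<in> V \<and> (\<forall>v\<in>V. (z - p) \<bullet> v = 0))"

lemma orth_proj_eqI:
  assumes V: "subspace V" and p: "p \<in> V" "\<forall>v\<in>V. (z - p) \<bullet> v = 0"
  shows "orth_proj V z = p"
  unfolding orth_proj_def
proof (rule the_equality)
  fix q assume q: "q \<in> V \<and> (\<forall>v\<in>V. (z - q) \<bullet> v = 0)"
  have "q - p \<in> V" using V p q by (simp add: subspace_diff)
  with p q have "(z - p) \<bullet> (q - p) - (z - q) \<bullet> (q - p) = 0" by simp
  then have "(q - p) \<bullet> (q - p) = 0" by (simp add: inner_diff_left)
  then show "q = p" by simp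
qed (use p in blast)

lemma orth_proj:
  assumes "subspace V"
  shows "orth_proj V z \<in> V" "\<forall>v\<in>V. (z - orth_proj V z) \<bullet> v = 0"
proof -
  have sp: "span V = V" using assms by simp
  obtain y w where "y \<in> V" "\<And>v. v \<in> V \<Longrightarrow> orthogonal w v" "z = y + w"
    using orthogonal_subspace_decomp_exists[of V z] unfolding sp by metis
  then have y: "y \<in> V" "\<forall>v\<in>V. (z - y) \<bullet> v = 0" by (auto simp: orthogonal_def)
  then show "orth_proj V z \<in> V" "\<forall>v\<in>V. (z - orth_proj V z) \<bullet> v = 0"
    using orth_proj_eqI[OF assms y] by auto
qed

definition lattice_annulus :: "real \<Rightarrow> real \<Rightarrow> int ^ 'n \<Rightarrow> int ^ 'n \<Rightarrow> (int ^ 'n) set" where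
  "lattice_annulus \<alpha> \<beta> a b =
    {z. \<alpha> \<le> norm (orth_proj (Xi a b) (real_vec z)) \<and> norm (orth_proj (Xi a b) (real_vec z)) \<le> \<beta>}"

definition Tstar :: "int ^ 'n \<Rightarrow> int ^ 'n \<Rightarrow> real ^ 'n \<Rightarrow> 'n::finite ray set" where
  "Tstar a b \<theta> = {gamma a b \<theta> z | z. True}"

definition Tstar_annulus ::
    "real \<Rightarrow> real \<Rightarrow> int ^ 'n \<Rightarrow> int ^ 'n \<Rightarrow> real ^ 'n \<Rightarrow> 'n::finite ray set" where
  "Tstar_annulus \<alpha> \<beta> a b \<theta> = {gamma a b \<theta> z | z. z \<in> lattice_annulus \<alpha> \<beta> a b}"

definition determines_on :: "real \<Rightarrow> 'n::finite ray set \<Rightarrow> (int ^ 'n) set \<Rightarrow> bool" where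
  "determines_on r L A \<longleftrightarrow>
    (\<forall>f g. supp f \<subseteq> lattice_ball r \<longrightarrow> supp g \<subseteq> lattice_ball r \<longrightarrow>
      (\<forall>\<gamma>\<in>L. xray f \<gamma> = xray g \<gamma>) \<longrightarrow> (\<forall>z\<in>A. f z = g z))"

text \<open>Layers are numbered from 1; index 0 is a dummy.\<close>

fun layer :: "'a::metric_space set \<Rightarrow> 'a \<Rightarrow> nat \<Rightarrow> 'a set" where
  "layer E x0 0 = {}"
| "layer E x0 (Suc i) =
    {z \<in> E - (\<Union>k\<in>{1..i}. layer E x0 k).
      \<forall>\<zeta> \<in> E - (\<Union>k\<in>{1..i}. layer E x0 k). dist z x0 \<ge> dist \<zeta> x0}"

definition num_layers :: "'a::metric_space set \<Rightarrow> 'a \<Rightarrow> nat" where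
  "num_layers E x0 = card {i. layer E x0 i \<noteq> {}}"

end

theory Submission
  imports Defs
begin

text \<open>The direction of the line \<open>\<gamma>\<^sub>z\<close> lies in \<open>\<Xi>\<^sub>a\<^sub>,\<^sub>b\<close> and is orthogonal to \<open>z\<close>. By
  Pythagoras, moving away from \<open>z\<close> along \<open>\<gamma>\<^sub>z\<close> strictly increases the distance to
  the origin and, as the direction lies in \<open>\<Xi>\<^sub>a\<^sub>,\<^sub>b\<close>, the distance to every \<open>x\<^sub>0\<close> orthogonal to \<open>\<Xi>\<^sub>a\<^sub>,\<^sub>b\<close> (lemma
  \<open>gamma_dist_less\<close>): \<open>f z\<close> enters \<open>\<P>f(\<gamma>\<^sub>z)\<close> only together with values of \<open>f\<close> farther out.

  For the formulas, every other support point on \<open>\<gamma>\<^sub>z\<close> lies in the same plane as \<open>z\<close>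
  and farther from \<open>x\<^sub>0\<close>, hence in an earlier layer; subtracting these values from
  \<open>\<P>f(\<gamma>\<^sub>z)\<close> leaves \<open>f z\<close> (lemma \<open>layer_formula\<close>).

  For uniqueness, let \<open>A\<close> contain, with each \<open>z\<close>, all lattice points of \<open>\<gamma>\<^sub>z\<close> in the ball
  \<open>B\<^sub>r\<close>. If \<open>f\<close> and \<open>g\<close> differed on \<open>A\<close>, then at a point \<open>z\<close> of \<open>A\<close> of largest norm where
  they differ, the transforms along \<open>\<gamma>\<^sub>z\<close> would differ by \<open>f z - g z\<close> (lemma
  \<open>determines_on_tangent_closed\<close>). All of \<open>\<int>\<^sup>d\<close> is such a set, and so is an annulus with
  \<open>\<beta> \<ge> r\<close>: along \<open>\<gamma>\<^sub>z\<close> the projection to \<open>\<Xi>\<^sub>a\<^sub>,\<^sub>b\<close> only gets longer, while in \<open>B\<^sub>r\<close> it never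
  exceeds \<open>r\<close>.\<close>

section \<open>Lattice points in a ball\<close>

lemma real_vec_eq_iff [simp]: "real_vec x = real_vec y \<longleftrightarrow> x = y"
  by (auto simp: real_vec_def vec_eq_iff)

lemma finite_lattice_ball: "finite (lattice_ball r :: (int ^ 'n) set)"
proof -
  have "lattice_ball r \<subseteq> vec_lambda ` (PiE UNIV (\<lambda>_::'n. {- \<lceil>r\<rceil>..\<lceil>r\<rceil>}))"
  proof
    fix z :: "int ^ 'n" assume "z \<in> lattice_ball r"
    then have "norm (real_vec z) \<le> r"
      by (simp add: lattice_ball_def)
    then have bound: "\<bar>real_of_int (z $ i)\<bar> \<le> r" for i
      using component_le_norm_cart[of "real_vec z" i] by (simp add: real_vec_def)
    have "z $ i \<in> {- \<lceil>r\<rceil>..\<lceil>r\<rceil>}" for i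
      using bound[of i] by simp linarith
    then have "vec_nth z \<in> PiE UNIV (\<lambda>_. {- \<lceil>r\<rceil>..\<lceil>r\<rceil>})"
      by auto
    then show "z \<in> vec_lambda ` (PiE UNIV (\<lambda>_. {- \<lceil>r\<rceil>..\<lceil>r\<rceil>}))"
      by (metis image_eqI vec_nth_inverse)
  qed
  then show ?thesis
    by (rule finite_subset) (intro finite_imageI finite_PiE; simp)
qed

section \<open>Geometry of the lines\<close>

lemma orth_Xi:
  assumes "x \<bullet> real_vec a = 0" "x \<bullet> real_vec b = 0" and "u \<in> Xi a b"
  shows "x \<bullet> u = 0"
proof -
  have "orthogonal x u"
    using assms(3) unfolding Xi_def
    by (rule orthogonal_to_span) (use assms in \<open>auto simp: orthogonal_def\<close>)
  then show ?thesis
    by (simp add: orthogonal_def)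
qed

lemma fst_gamma_in_Xi: "\<theta> \<in> Xi a b \<Longrightarrow> fst (gamma a b \<theta> z) \<in> Xi a b"
  by (simp add: gamma_def star_dir_def Xi_def Let_def span_mul span_add span_diff span_neg span_base)

lemma base_point_on_gamma: "real_vec z \<in> ray_points (gamma a b \<theta> z)"
proof -
  have "real_vec z = snd (gamma a b \<theta> z) + 0 *\<^sub>R fst (gamma a b \<theta> z)"
    by (simp add: gamma_def)
  then show ?thesis
    unfolding ray_points_def by blast
qed

lemma gamma_pointE:
  assumes ind: "independent {real_vec a, real_vec b}" "a \<noteq> b"
    and th: "\<theta> \<in> Omega \<inter> Xi a b"
    and y: "y \<in> ray_points (gamma a b \<theta> z)"
  obtains w where "w \<in> Xi a b" "real_vec z \<bullet> w = 0" "y = real_vec z + w"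
proof -
  let ?u = "fst (gamma a b \<theta> z)"
  have base: "snd (gamma a b \<theta> z) = real_vec z"
    by (simp add: gamma_def)
  obtain t where t: "y = real_vec z + t *\<^sub>R ?u"
    using y base by (auto simp: ray_points_def)
  have "real_vec z \<bullet> ?u = 0"
    using gamma_in_rays[OF ind th, of z] base by (auto simp: rays_def case_prod_beta)
  moreover have "t *\<^sub>R ?u \<in> Xi a b"
    using fst_gamma_in_Xi[of \<theta> a b z] th by (simp add: Xi_def span_mul)
  ultimately show ?thesis
    using that t by simp
qed

text \<open>The case \<open>x0 = 0\<close> is the one used for uniqueness.\<close>

lemma gamma_dist_less:
  assumes ind: "independent {real_vec a, real_vec b}" "a \<noteq> b"
    and th: "\<theta> \<in> Omega \<inter> Xi a b"
    and y: "y \<in> ray_points (gamma a b \<theta> z)" "y \<noteq> real_vec z"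
    and x0: "x0 \<bullet> real_vec a = 0" "x0 \<bullet> real_vec b = 0"
  shows "dist (real_vec z) x0 < dist y x0"
proof -
  obtain w where w: "w \<in> Xi a b" "real_vec z \<bullet> w = 0" "y = real_vec z + w"
    using gamma_pointE[OF ind th y(1)] .
  have "orthogonal (real_vec z - x0) w"
    using w(2) orth_Xi[OF x0 w(1)] by (simp add: orthogonal_def inner_diff_left)
  then have "(norm (real_vec z - x0 + w))\<^sup>2 = (norm (real_vec z - x0))\<^sup>2 + (norm w)\<^sup>2"
    by (rule norm_add_Pythagorean)
  moreover have "0 < (norm w)\<^sup>2"
    using y(2) w(3) by simp
  moreover have yw: "y - x0 = real_vec z - x0 + w"
    using w(3) by simp
  ultimately have "(norm (real_vec z - x0))\<^sup>2 < (norm (y - x0))\<^sup>2"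
    unfolding yw by linarith
  then show ?thesis
    unfolding dist_norm by (rule power2_less_imp_less) simp
qed

section \<open>Recovery from the outermost layer inwards\<close>

text \<open>The set \<open>T\<close> may contain points where \<open>f\<close> vanishes.\<close>

lemma xray_split_point:
  assumes "finite T" and T: "\<And>y. y \<in> T \<Longrightarrow> real_vec y \<in> ray_points \<gamma>"
    and z: "real_vec z \<in> ray_points \<gamma>" "z \<notin> T"
    and cover: "\<And>y. real_vec y \<in> ray_points \<gamma> \<Longrightarrow> y \<noteq> z \<Longrightarrow> f y \<noteq> 0 \<Longrightarrow> y \<in> T"
  shows "xray f \<gamma> = f z + sum f T"
proof -
  have "xray f \<gamma> = infsum f (insert z T)"
    unfolding xray_def by (rule infsum_cong_neutral) (use T z cover in auto)
  also have "\<dots> = f z + sum f T"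
    using assms by simp
  finally show ?thesis .
qed

lemma layer_subset: "layer E x0 i \<subseteq> E"
  by (cases i) auto

lemma layer_formula:
  fixes a b :: "int ^ 'n" and x0 :: "real ^ 'n"
  assumes ind: "independent {real_vec a, real_vec b}" "a \<noteq> b"
    and th: "\<theta> \<in> Omega \<inter> Xi a b"
    and f: "supp f \<subseteq> lattice_ball r"
    and x0: "x0 \<bullet> real_vec a = 0" "x0 \<bullet> real_vec b = 0"
    and E: "E = cball 0 r \<inter> (\<lambda>v. v + x0) ` Xi a b \<inter> range real_vec"
    and z: "real_vec z \<in> layer E x0 (Suc i)"
  shows "f z = xray f (gamma a b \<theta> z)
    - (\<Sum>\<zeta> | real_vec \<zeta> \<in> ray_points (gamma a b \<theta> z) \<inter> (\<Union>k\<in>{1..i}. layer E x0 k). f \<zeta>)"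
proof -
  let ?U = "\<Union>k\<in>{1..i}. layer E x0 k"
  let ?T = "{\<zeta>. real_vec \<zeta> \<in> ray_points (gamma a b \<theta> z) \<inter> ?U}"
  \<comment> \<open>Layer \<open>i + 1\<close> is as far from \<open>x0\<close> as possible once the layers \<open>1, \<dots>, i\<close> are removed,
    so every point of \<open>E\<close> that is still farther away belongs to one of these.\<close>
  have zE: "real_vec z \<in> E" and zU: "real_vec z \<notin> ?U"
    and far: "\<And>x. x \<in> E \<Longrightarrow> dist (real_vec z) x0 < dist x x0 \<Longrightarrow> x \<in> ?U"
    using z unfolding layer.simps(2) mem_Collect_eq not_le[symmetric] by blast+
  have "?U \<subseteq> E"
    using layer_subset by blast
  then have "?T \<subseteq> lattice_ball r"
    by (auto simp: E lattice_ball_def)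
  then have fin: "finite ?T"
    by (rule finite_subset) (rule finite_lattice_ball)
  have "xray f (gamma a b \<theta> z) = f z + sum f ?T"
  proof (rule xray_split_point[OF fin])
    fix y assume y: "real_vec y \<in> ray_points (gamma a b \<theta> z)" "y \<noteq> z" "f y \<noteq> 0"
    obtain w where w: "w \<in> Xi a b" "real_vec y = real_vec z + w"
      using gamma_pointE[OF ind th y(1)] by metis
    obtain v where v: "v \<in> Xi a b" "real_vec z = v + x0"
      using zE by (auto simp: E)
    have "v + w \<in> Xi a b"
      using v(1) w(1) by (simp add: Xi_def span_add)
    moreover have "real_vec y = (v + w) + x0"
      using v(2) w(2) by simp
    ultimately have "real_vec y \<in> (\<lambda>v. v + x0) ` Xi a b"
      by blast
    moreover have "real_vec y \<in> cball 0 r"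
      using f y(3) by (auto simp: supp_def lattice_ball_def)
    ultimately have "real_vec y \<in> E"
      by (simp add: E)
    moreover have "dist (real_vec z) x0 < dist (real_vec y) x0"
      using gamma_dist_less[OF ind th y(1) _ x0] y(2) by simp
    ultimately show "y \<in> ?T"
      using far y(1) by blast
  qed (use zU base_point_on_gamma in auto)
  then show ?thesis
    by simp
qed

section \<open>Uniqueness\<close>

lemma determines_on_tangent_closed:
  fixes a b :: "int ^ 'n"
  assumes ind: "independent {real_vec a, real_vec b}" "a \<noteq> b"
    and th: "\<theta> \<in> Omega \<inter> Xi a b"
    and closed: "\<And>z y. z \<in> A \<Longrightarrow> real_vec y \<in> ray_points (gamma a b \<theta> z) \<Longrightarrow>
      y \<in> lattice_ball r \<Longrightarrow> y \<in> A"
  shows "determines_on r {gamma a b \<theta> z | z. z \<in> A} A"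
  unfolding determines_on_def
proof (intro allI impI)
  fix f g :: "int ^ 'n \<Rightarrow> complex"
  assume f: "supp f \<subseteq> lattice_ball r" and g: "supp g \<subseteq> lattice_ball r"
    and eq: "\<forall>\<gamma>\<in>{gamma a b \<theta> z | z. z \<in> A}. xray f \<gamma> = xray g \<gamma>"
  show "\<forall>z\<in>A. f z = g z"
  proof (rule ccontr)
    define D where "D = {z \<in> A. f z \<noteq> g z}"
    assume "\<not> (\<forall>z\<in>A. f z = g z)"
    then have "D \<noteq> {}"
      by (auto simp: D_def)
    moreover have "D \<subseteq> supp f \<union> supp g"
      by (auto simp: D_def supp_def)
    then have "finite D"
      by (rule finite_subset) (use f g finite_lattice_ball finite_subset in blast)
    ultimately obtain z where z: "z \<in> D"
      and Max: "norm (real_vec z) = Max ((\<lambda>y. norm (real_vec y)) ` D)"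
      using obtains_MAX by metis
    have max: "norm (real_vec y) \<le> norm (real_vec z)" if "y \<in> D" for y
      unfolding Max using \<open>finite D\<close> that by simp
    define T where "T = {y. real_vec y \<in> ray_points (gamma a b \<theta> z) \<and> y \<noteq> z} \<inter> lattice_ball r"
    have fin: "finite T"
      by (simp add: T_def finite_lattice_ball)
    have "f y = g y" if "y \<in> T" for y
    proof -
      have "norm (real_vec z) < norm (real_vec y)"
        using gamma_dist_less[OF ind th, of "real_vec y" z 0] that by (simp add: T_def)
      then have "y \<notin> D"
        using max[of y] by auto
      moreover have "y \<in> A"
        using closed[of z y] z that by (simp add: T_def D_def)
      ultimately show ?thesis
        by (simp add: D_def)
    qed
    then have "sum f T = sum g T"
      by (rule sum.cong[OF refl])
    moreover have "xray h (gamma a b \<theta> z) = h z + sum h T" if "supp h \<subseteq> lattice_ball r" for h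
      by (rule xray_split_point[OF fin])
        (use that base_point_on_gamma in \<open>auto simp: T_def supp_def\<close>)
    moreover have "xray f (gamma a b \<theta> z) = xray g (gamma a b \<theta> z)"
      using eq z unfolding D_def by blast
    ultimately have "f z = g z"
      using f g by simp
    then show False
      using z by (simp add: D_def)
  qed
qed

section \<open>Annuli\<close>

lemma orthogonal_orth_proj:
  assumes "subspace V" "w \<in> V" "z \<bullet> w = 0"
  shows "orthogonal (orth_proj V z) w"
  using orth_proj(2)[OF assms(1), of z] assms(2,3)
  by (simp add: orthogonal_def inner_diff_left)

lemma orth_proj_add:
  assumes "subspace V" "w \<in> V"
  shows "orth_proj V (z + w) = orth_proj V z + w"
  using orth_proj[OF assms(1), of z] assms
  by (intro orth_proj_eqI) (auto simp: subspace_add algebra_simps)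

lemma norm_orth_proj_le:
  assumes "subspace V"
  shows "norm (orth_proj V z) \<le> norm z"
proof -
  let ?p = "orth_proj V z"
  have "orthogonal (z - ?p) ?p"
    using orth_proj[OF assms, of z] by (simp add: orthogonal_def)
  then have "(norm (z - ?p + ?p))\<^sup>2 = (norm (z - ?p))\<^sup>2 + (norm ?p)\<^sup>2"
    by (rule norm_add_Pythagorean)
  then have "(norm ?p)\<^sup>2 \<le> (norm z)\<^sup>2"
    by simp
  then show ?thesis
    by (rule power2_le_imp_le) simp
qed

lemma lattice_annulus_tangent_closed:
  fixes a b :: "int ^ 'n"
  assumes ind: "independent {real_vec a, real_vec b}" "a \<noteq> b"
    and th: "\<theta> \<in> Omega \<inter> Xi a b" and "r \<le> \<beta>"
    and z: "z \<in> lattice_annulus \<alpha> \<beta> a b"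
    and y: "real_vec y \<in> ray_points (gamma a b \<theta> z)" "y \<in> lattice_ball r"
  shows "y \<in> lattice_annulus \<alpha> \<beta> a b"
proof -
  let ?p = "orth_proj (Xi a b)"
  have V: "subspace (Xi a b)"
    by (simp add: Xi_def)
  obtain w where w: "w \<in> Xi a b" "real_vec z \<bullet> w = 0" "real_vec y = real_vec z + w"
    using gamma_pointE[OF ind th y(1)] .
  have "(norm (?p (real_vec y)))\<^sup>2 = (norm (?p (real_vec z)))\<^sup>2 + (norm w)\<^sup>2"
    unfolding w(3) orth_proj_add[OF V w(1)]
    by (rule norm_add_Pythagorean[OF orthogonal_orth_proj[OF V w(1,2)]])
  then have "norm (?p (real_vec z)) \<le> norm (?p (real_vec y))"
    by (simp add: power2_le_imp_le)
  moreover have "norm (?p (real_vec y)) \<le> \<beta>"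
    using norm_orth_proj_le[OF V, of "real_vec y"] y(2) \<open>r \<le> \<beta>\<close> by (simp add: lattice_ball_def)
  ultimately show ?thesis
    using z by (simp add: lattice_annulus_def)
qed

theorem theorem2p2:
  fixes a b :: "int ^ 'n" and \<theta> :: "real ^ 'n" and r :: real
    and f :: "int ^ 'n \<Rightarrow> complex"
  assumes "CARD('n) \<ge> 2"
    and "r > 0"
    and "a \<noteq> b" and "independent {real_vec a, real_vec b}"
    and "\<theta> \<in> Omega \<inter> Xi a b"
    and "supp f \<subseteq> lattice_ball r"
  shows "determines_on r (Tstar a b \<theta>) UNIV
    \<and> (\<forall>x0 :: real ^ 'n.
        x0 \<bullet> real_vec a = 0 \<longrightarrow> x0 \<bullet> real_vec b = 0 \<longrightarrow>
        (\<lambda>v. v + x0) ` Xi a b \<inter> range real_vec \<noteq> {} \<longrightarrow>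
        cball 0 r \<inter> (\<lambda>v. v + x0) ` Xi a b \<inter> range real_vec \<noteq> {} \<longrightarrow>
        (let S = layer (cball 0 r \<inter> (\<lambda>v. v + x0) ` Xi a b \<inter> range real_vec) x0;
             J = num_layers (cball 0 r \<inter> (\<lambda>v. v + x0) ` Xi a b \<inter> range real_vec) x0
         in (\<forall>z. real_vec z \<in> S 1 \<longrightarrow> f z = xray f (gamma a b \<theta> z))
          \<and> (\<forall>i\<in>{1..<J}. \<forall>z. real_vec z \<in> S (i + 1) \<longrightarrow>
               f z = xray f (gamma a b \<theta> z)
                 - (\<Sum>\<zeta> | real_vec \<zeta> \<in> ray_points (gamma a b \<theta> z) \<inter> (\<Union>k\<in>{1..i}. S k). f \<zeta>))))
    \<and> (\<forall>\<alpha> \<beta> :: real. 0 \<le> \<alpha> \<longrightarrow> \<alpha> \<le> \<beta> \<longrightarrow> r \<le> \<beta> \<longrightarrow>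
        determines_on r (Tstar_annulus \<alpha> \<beta> a b \<theta>) (lattice_annulus \<alpha> \<beta> a b))"
proof (intro conjI)
  note ind = \<open>independent {real_vec a, real_vec b}\<close> \<open>a \<noteq> b\<close>
    and th = \<open>\<theta> \<in> Omega \<inter> Xi a b\<close>
  show "determines_on r (Tstar a b \<theta>) UNIV"
    using determines_on_tangent_closed[OF ind th, of UNIV r] by (simp add: Tstar_def)
  show "\<forall>\<alpha> \<beta> :: real. 0 \<le> \<alpha> \<longrightarrow> \<alpha> \<le> \<beta> \<longrightarrow> r \<le> \<beta> \<longrightarrow>
      determines_on r (Tstar_annulus \<alpha> \<beta> a b \<theta>) (lattice_annulus \<alpha> \<beta> a b)"
  proof (intro allI impI)
    fix \<alpha> \<beta> :: real assume "r \<le> \<beta>"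
    then show "determines_on r (Tstar_annulus \<alpha> \<beta> a b \<theta>) (lattice_annulus \<alpha> \<beta> a b)"
      unfolding Tstar_annulus_def
      by (intro determines_on_tangent_closed[OF ind th])
        (rule lattice_annulus_tangent_closed[OF ind th])
  qed
  show "\<forall>x0 :: real ^ 'n.
        x0 \<bullet> real_vec a = 0 \<longrightarrow> x0 \<bullet> real_vec b = 0 \<longrightarrow>
        (\<lambda>v. v + x0) ` Xi a b \<inter> range real_vec \<noteq> {} \<longrightarrow>
        cball 0 r \<inter> (\<lambda>v. v + x0) ` Xi a b \<inter> range real_vec \<noteq> {} \<longrightarrow>
        (let S = layer (cball 0 r \<inter> (\<lambda>v. v + x0) ` Xi a b \<inter> range real_vec) x0;
             J = num_layers (cball 0 r \<inter> (\<lambda>v. v + x0) ` Xi a b \<inter> range real_vec) x0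
         in (\<forall>z. real_vec z \<in> S 1 \<longrightarrow> f z = xray f (gamma a b \<theta> z))
          \<and> (\<forall>i\<in>{1..<J}. \<forall>z. real_vec z \<in> S (i + 1) \<longrightarrow>
               f z = xray f (gamma a b \<theta> z)
                 - (\<Sum>\<zeta> | real_vec \<zeta> \<in> ray_points (gamma a b \<theta> z) \<inter> (\<Union>k\<in>{1..i}. S k). f \<zeta>)))"
  proof (intro allI impI)
    fix x0 :: "real ^ 'n"
    assume x0: "x0 \<bullet> real_vec a = 0" "x0 \<bullet> real_vec b = 0"
    let ?E = "cball 0 r \<inter> (\<lambda>v. v + x0) ` Xi a b \<inter> range real_vec"
    note formula = layer_formula[OF ind th \<open>supp f \<subseteq> lattice_ball r\<close> x0 refl]
    have outer: "f z = xray f (gamma a b \<theta> z)" if "real_vec z \<in> layer ?E x0 1" for z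
    proof -
      have "real_vec z \<in> layer ?E x0 (Suc 0)"
        using that unfolding One_nat_def .
      from formula[OF this] show ?thesis
        by simp
    qed
    show "let S = layer ?E x0; J = num_layers ?E x0
         in (\<forall>z. real_vec z \<in> S 1 \<longrightarrow> f z = xray f (gamma a b \<theta> z))
          \<and> (\<forall>i\<in>{1..<J}. \<forall>z. real_vec z \<in> S (i + 1) \<longrightarrow>
               f z = xray f (gamma a b \<theta> z)
                 - (\<Sum>\<zeta> | real_vec \<zeta> \<in> ray_points (gamma a b \<theta> z) \<inter> (\<Union>k\<in>{1..i}. S k). f \<zeta>))"
      unfolding Let_def
    proof (intro conjI allI ballI impI)
      fix i z assume "real_vec z \<in> layer ?E x0 (i + 1)"
      then have "real_vec z \<in> layer ?E x0 (Suc i)"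
        unfolding Suc_eq_plus1 .
      then show "f z = xray f (gamma a b \<theta> z)
          - (\<Sum>\<zeta> | real_vec \<zeta> \<in> ray_points (gamma a b \<theta> z) \<inter> (\<Union>k\<in>{1..i}. layer ?E x0 k). f \<zeta>)"
        by (rule formula)
    qed (rule outer)
  qed
qed

end
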